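(* Let $d\ge 2$, $n\ge d$ and $k\ge 1$ be integers. Then the distance $k$-domination number of the generalized de Bruijn digraph $G_B(n,d)$ satisfies $$\gamma_k(G_B(n,d)) = \left\lceil n \Big/ \sum_{j=0}^k d^j \right\rceil \quad\text{or}\quad \gamma_k(G_B(n,d)) = \left\lceil n \Big/ \sum_{j=0}^k d^j \right\rceil + 1.$$
   Context: Digraphs may have self-loops but no multiple arcs. The generalized de Bruijn digraph $G_B(n,d)$ has vertex set $\{0,1,\dots,n-1\}$ and an arc $(x,y)$ whenever $y\equiv dx+i \pmod n$ for some $0\le i\le d-1$. For vertices $u,v$ of a digraph $G$, the distance $d_G(u,v)$ is the length of a shortest directed path from $u$ to $v$ (with $d_G(u,u)=0$). A set $D\subseteq V(G)$ is a distance $k$-dominating set if every vertex $v\notin D$ has some $u\in D$ with $d_G(u,v)\le k$. The distance $k$-domination number $\gamma_k(G)$ is the minimum cardinality of a distance $k$-dominating set of $G$. *)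

theory Defs
  imports
    Complex_Main
    "HOL-Library.Extended_Nat"
    "HOL-Number_Theory.Cong"
    "Graph_Theory.Pair_Digraph"
begin

definition gen_de_bruijn :: "nat \<Rightarrow> nat \<Rightarrow> nat pair_pre_digraph" where
  "gen_de_bruijn n d =
     \<lparr> pverts = {0..<n},
       parcs = {(x, y). x \<in> {0..<n} \<and> y \<in> {0..<n} \<and>
                  (\<exists>i. i < d \<and> [y = d * x + i] (mod n))} \<rparr>"

text \<open>The distance is \<open>\<infinity>\<close> if there is no directed path from \<open>u\<close> to \<open>v\<close>.\<close>

definition ddist :: "('a, 'b) pre_digraph \<Rightarrow> 'a \<Rightarrow> 'a \<Rightarrow> enat" where
  "ddist G u v = (INF p \<in> {p. pre_digraph.apath G u p v}. enat (length p))"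

definition distance_dominating :: "('a, 'b) pre_digraph \<Rightarrow> nat \<Rightarrow> 'a set \<Rightarrow> bool" where
  "distance_dominating G k D \<longleftrightarrow>
     D \<subseteq> verts G \<and> (\<forall>v \<in> verts G - D. \<exists>u \<in> D. ddist G u v \<le> enat k)"

definition distance_domination_number :: "('a, 'b) pre_digraph \<Rightarrow> nat \<Rightarrow> nat" where
  "distance_domination_number G k =
     (LEAST m. \<exists>D. finite D \<and> distance_dominating G k D \<and> card D = m)"

lemma pair_fin_digraph_gen_de_bruijn: "pair_fin_digraph (gen_de_bruijn n d)"
proof
  show "finite (parcs (gen_de_bruijn n d))"
    by (rule finite_subset[of _ "{0..<n} \<times> {0..<n}"]) (auto simp: gen_de_bruijn_def)
qed (auto simp: gen_de_bruijn_def)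

lemma ddist_self:
  assumes "u \<in> verts G"
  shows "ddist G u u = 0"
proof -
  have "pre_digraph.apath G u [] u"
    using assms by (simp add: pre_digraph.apath_def pre_digraph.awalk_def
        pre_digraph.cas.simps pre_digraph.awalk_verts.simps)
  then have "ddist G u u \<le> enat (length ([] :: 'b list))"
    unfolding ddist_def by (intro INF_lower) simp
  then show ?thesis by (simp flip: zero_enat_def)
qed

lemma distance_domination_number_attained:
  assumes "finite (verts G)"
  shows "\<exists>D. finite D \<and> distance_dominating G k D \<and> card D = distance_domination_number G k"
proof -
  have "distance_dominating G k (verts G)"
    by (simp add: distance_dominating_def)
  with assms have "\<exists>m D. finite D \<and> distance_dominating G k D \<and> card D = m" by blast
  then show ?thesis
    unfolding distance_domination_number_def by (rule LeastI_ex)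
qed

end

theory Submission
  imports Defs
begin

text \<open>
  The vertices at walk distance \<open>j\<close> from \<open>u\<close> are the residues of \<open>d ^ j * u + r\<close> with
  \<open>r < d ^ j\<close>, so a vertex dominates at most \<open>1 + d + \<dots> + d ^ k\<close> vertices; this gives the lower
  bound \<open>m = \<lceil>n / (1 + d + \<dots> + d ^ k)\<rceil>\<close>. For the upper bound take \<open>t = m + 1\<close> consecutive vertices
  starting at \<open>x\<close>, where \<open>(d - 1) * x\<close> is congruent to the largest multiple \<open>c \<le> t\<close> of
  \<open>gcd (d - 1) n\<close>. The \<open>j\<close>-th out-neighbourhood of this block is a block of length \<open>d ^ j * t\<close>
  starting at \<open>x + c * (1 + \<dots> + d ^ (j - 1))\<close>. As \<open>c \<le> t\<close>, successive blocks leave no gap, and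
  as \<open>t - c < d - 1\<close>, the loss by overlaps is less than \<open>d ^ k\<close>, which the additional vertex
  compensates.
\<close>

section \<open>Distance expressed through walks\<close>

lemma (in wf_digraph) ex_apath_length_le:
  assumes "awalk u p v"
  shows "\<exists>q. apath u q v \<and> length q \<le> length p"
  using assms
proof (induct rule: awalk_to_apath_induct)
  case (path p)
  then show ?case by (auto simp: apath_def)
next
  case (decomp p q r s)
  from decomp have "p = q @ r @ s"
    by (auto elim: awalk_cyc_decompE)
  with decomp show ?case by force
qed

text \<open>\<open>ddist\<close> minimizes over paths, but cutting cycles out of a walk only
  shortens it. Walks are easier to handle, since prepending an arc needs no check for repeated
  vertices.\<close>

lemma (in wf_digraph) ddist_le_iff:
  "ddist G u v \<le> enat k \<longleftrightarrow> (\<exists>p. awalk u p v \<and> length p \<le> k)"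
proof
  assume le: "ddist G u v \<le> enat k"
  show "\<exists>p. awalk u p v \<and> length p \<le> k"
  proof (rule ccontr)
    assume no: "\<not> ?thesis"
    \<comment> \<open>A lower bound on every path length also covers the infimum of the empty set,
      which is \<infinity>.\<close>
    have "enat (Suc k) \<le> ddist G u v"
      unfolding ddist_def
    proof (rule INF_greatest)
      fix p assume "p \<in> {p. apath u p v}"
      with no show "enat (Suc k) \<le> enat (length p)"
        by (auto simp: apath_def not_le Suc_le_eq)
    qed
    with le have "enat (Suc k) \<le> enat k" by (rule order_trans[rotated])
    then show False by simp
  qed
next
  assume "\<exists>p. awalk u p v \<and> length p \<le> k"
  then obtain q where q: "apath u q v" "length q \<le> k"
    using ex_apath_length_le order_trans by blast
  then have "ddist G u v \<le> enat (length q)"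
    unfolding ddist_def by (intro INF_lower) simp
  with q(2) show "ddist G u v \<le> enat k"
    by (meson enat_ord_simps(1) order_trans)
qed

section \<open>Walks in the generalized de Bruijn digraph\<close>

lemma pverts_gen_de_bruijn [simp]: "pverts (gen_de_bruijn n d) = {0..<n}"
  by (simp add: gen_de_bruijn_def)

lemma parcs_gen_de_bruijn_iff:
  "(x, y) \<in> parcs (gen_de_bruijn n d) \<longleftrightarrow>
    x < n \<and> y < n \<and> (\<exists>i<d. [y = d * x + i] (mod n))"
  by (simp add: gen_de_bruijn_def)

text \<open>Following an arc appends a base-\<open>d\<close> digit modulo \<open>n\<close>; the
  number \<open>r\<close> collects the \<open>j\<close> digits of the walk, the first arc giving the
  leading one.\<close>

lemma gen_de_bruijn_awalk_iff:
  assumes "u < n" "v < n" "d > 0"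
  shows "(\<exists>p. pre_digraph.awalk (with_proj (gen_de_bruijn n d)) u p v \<and> length p = j)
     \<longleftrightarrow> (\<exists>r<d ^ j. [v = d ^ j * u + r] (mod n))"
proof -
  interpret pair_fin_digraph "gen_de_bruijn n d" by (rule pair_fin_digraph_gen_de_bruijn)
  show ?thesis
    using assms(1)
  proof (induction j arbitrary: u)
    case 0
    then show ?case
      using assms(2) by (auto simp: awalk_Nil_iff cong_def)
  next
    case (Suc j)
    have "(\<exists>p. awalk u p v \<and> length p = Suc j) \<longleftrightarrow>
        (\<exists>w i. w < n \<and> i < d \<and> [w = d * u + i] (mod n) \<and> (\<exists>p. awalk w p v \<and> length p = j))"
      (is "?L \<longleftrightarrow> ?R")
    proof
      assume ?L
      then obtain w p where "(u, w) \<in> parcs (gen_de_bruijn n d)" "awalk w p v" "length p = j"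
        by (auto simp: length_Suc_conv awalk_Cons_iff)
      then show ?R by (auto simp: parcs_gen_de_bruijn_iff)
    next
      assume ?R
      then obtain w p where "(u, w) \<in> parcs (gen_de_bruijn n d)" "awalk w p v" "length p = j"
        using Suc.prems by (auto simp: parcs_gen_de_bruijn_iff)
      then have "awalk u ((u, w) # p) v" "length ((u, w) # p) = Suc j"
        by (auto simp: awalk_Cons_iff)
      then show ?L by blast
    qed
    also have "\<dots> \<longleftrightarrow> (\<exists>w i. w < n \<and> i < d \<and> [w = d * u + i] (mod n) \<and>
        (\<exists>r<d ^ j. [v = d ^ j * w + r] (mod n)))"
      using Suc.IH by blast
    also have "\<dots> \<longleftrightarrow> (\<exists>r<d ^ Suc j. [v = d ^ Suc j * u + r] (mod n))"
    proof (intro iffI; elim exE conjE)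
      fix w i r
      assume i: "i < d" and w: "[w = d * u + i] (mod n)"
        and r: "r < d ^ j" and v: "[v = d ^ j * w + r] (mod n)"
      have "[d ^ j * w + r = d ^ j * (d * u + i) + r] (mod n)"
        using w by (intro cong_add cong_mult cong_refl)
      with v have "[v = d ^ j * (d * u + i) + r] (mod n)" by (rule cong_trans)
      then have "[v = d ^ Suc j * u + (d ^ j * i + r)] (mod n)"
        by (simp add: algebra_simps)
      moreover have "d ^ j * i + r < d ^ Suc j"
      proof -
        have "d ^ j * i + r < d ^ j * Suc i" using r by simp
        also have "\<dots> \<le> d ^ j * d" using i by (intro mult_le_mono) auto
        finally show ?thesis by (simp add: mult.commute)
      qed
      ultimately show "\<exists>r<d ^ Suc j. [v = d ^ Suc j * u + r] (mod n)" by blast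
    next
      fix r
      assume r: "r < d ^ Suc j" and v: "[v = d ^ Suc j * u + r] (mod n)"
      \<comment> \<open>The leading digit of \<open>r\<close> selects the first arc, the remaining
        \<open>j\<close> digits the rest of the walk.\<close>
      define i where "i = r div d ^ j"
      define w where "w = (d * u + i) mod n"
      have i: "i < d"
        using r by (simp add: i_def less_mult_imp_div_less)
      have w: "[w = d * u + i] (mod n)" "w < n"
        using assms(1,2) by (auto simp: w_def)
      have "d ^ Suc j * u + r = d ^ j * (d * u + i) + r mod d ^ j"
        by (simp add: i_def algebra_simps)
      with v have "[v = d ^ j * (d * u + i) + r mod d ^ j] (mod n)" by simp
      moreover have "[d ^ j * (d * u + i) + r mod d ^ j = d ^ j * w + r mod d ^ j] (mod n)"
        using w(1) by (intro cong_add cong_mult cong_refl) (rule cong_sym)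
      ultimately have "[v = d ^ j * w + r mod d ^ j] (mod n)" by (rule cong_trans)
      moreover have "r mod d ^ j < d ^ j" using assms(3) by simp
      ultimately show "\<exists>w i. w < n \<and> i < d \<and> [w = d * u + i] (mod n) \<and>
          (\<exists>r<d ^ j. [v = d ^ j * w + r] (mod n))"
        using i w by blast
    qed
    finally show ?case .
  qed
qed

lemma gen_de_bruijn_ddist_le_iff:
  assumes "u < n" "v < n" "d > 0"
  shows "ddist (with_proj (gen_de_bruijn n d)) u v \<le> enat k
     \<longleftrightarrow> (\<exists>j\<le>k. \<exists>r<d ^ j. [v = d ^ j * u + r] (mod n))"
proof -
  interpret pair_fin_digraph "gen_de_bruijn n d" by (rule pair_fin_digraph_gen_de_bruijn)
  show ?thesis
    unfolding ddist_le_iff using gen_de_bruijn_awalk_iff[OF assms] by metis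
qed

section \<open>Domination as a covering of residues; the lower bound\<close>

lemma gen_de_bruijn_dominating_iff:
  assumes "d > 0"
  shows "distance_dominating (with_proj (gen_de_bruijn n d)) k D \<longleftrightarrow>
    D \<subseteq> {0..<n} \<and> (\<forall>v<n. \<exists>u\<in>D. \<exists>j\<le>k. \<exists>r<d ^ j. [v = d ^ j * u + r] (mod n))"
proof (cases "D \<subseteq> {0..<n}")
  case True
  \<comment> \<open>Members of \<open>D\<close> are within distance 0 of themselves, so the
    condition may be imposed on all vertices instead of only those outside \<open>D\<close>.\<close>
  then have self: "ddist (with_proj (gen_de_bruijn n d)) u u \<le> enat k" if "u \<in> D" for u
    using that by (subst ddist_self) auto
  have "(\<forall>v\<in>{0..<n} - D. \<exists>u\<in>D. ddist (with_proj (gen_de_bruijn n d)) u v \<le> enat k)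
    \<longleftrightarrow> (\<forall>v<n. \<exists>u\<in>D. ddist (with_proj (gen_de_bruijn n d)) u v \<le> enat k)"
    using self by (metis DiffI atLeastLessThan_iff DiffD1 zero_le)
  also have "\<dots> \<longleftrightarrow> (\<forall>v<n. \<exists>u\<in>D. \<exists>j\<le>k. \<exists>r<d ^ j. [v = d ^ j * u + r] (mod n))"
    using True assms by (intro all_cong bex_cong refl gen_de_bruijn_ddist_le_iff) auto
  finally show ?thesis
    using True by (simp add: distance_dominating_def)
qed (simp add: distance_dominating_def)

text \<open>Each vertex is the residue of \<open>d ^ j * u + r\<close> for some triple
  \<open>(u, j, r)\<close>, so there are at least \<open>n\<close> such triples.\<close>

lemma gen_de_bruijn_dominating_card_ge:
  assumes "d > 0" "distance_dominating (with_proj (gen_de_bruijn n d)) k D"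
  shows "n \<le> card D * (\<Sum>j=0..k. d ^ j)"
proof -
  have D: "D \<subseteq> {0..<n}"
    and dom: "\<forall>v<n. \<exists>u\<in>D. \<exists>j\<le>k. \<exists>r<d ^ j. [v = d ^ j * u + r] (mod n)"
    using assms by (simp_all add: gen_de_bruijn_dominating_iff)
  have fin: "finite D" using D by (rule finite_subset) simp
  let ?P = "D \<times> (SIGMA j:{0..k}. {..<d ^ j})"
  have "{0..<n} \<subseteq> (\<lambda>(u, j, r). (d ^ j * u + r) mod n) ` ?P"
  proof
    fix v assume v: "v \<in> {0..<n}"
    with dom obtain u j r where "u \<in> D" "j \<le> k" "r < d ^ j" "[v = d ^ j * u + r] (mod n)"
      by auto
    with v show "v \<in> (\<lambda>(u, j, r). (d ^ j * u + r) mod n) ` ?P"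
      by (intro image_eqI[of _ _ "(u, j, r)"]) (auto simp: cong_def)
  qed
  then have "card {0..<n} \<le> card ?P"
    using fin by (intro surj_card_le) auto
  then show ?thesis
    using fin by (simp add: card_cartesian_product)
qed

section \<open>Upper bound from a block of consecutive vertices\<close>

lemma consecutive_blocks_cover:
  fixes c d t q :: nat
  assumes "c \<le> t" "q < c * (\<Sum>i<k. d ^ i) + d ^ k * t"
  shows "\<exists>j\<le>k. \<exists>p<d ^ j * t. q = c * (\<Sum>i<j. d ^ i) + p"
  using assms(2)
proof (induction k)
  case 0
  then show ?case by simp
next
  case (Suc k)
  show ?case
  proof (cases "q < c * (\<Sum>i<k. d ^ i) + d ^ k * t")
    case True
    then show ?thesis using Suc.IH by (meson le_SucI)
  next
    case False
    \<comment> \<open>The next block starts \<open>c * d ^ k\<close> after the start of the current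
      one, whose length is \<open>d ^ k * t\<close>; hence \<open>c \<le> t\<close> excludes a
      gap.\<close>
    have "c * (\<Sum>i<Suc k. d ^ i) \<le> c * (\<Sum>i<k. d ^ i) + d ^ k * t"
      using assms(1) by (simp add: algebra_simps)
    with False have "c * (\<Sum>i<Suc k. d ^ i) \<le> q" by linarith
    then obtain p where "q = c * (\<Sum>i<Suc k. d ^ i) + p" using le_Suc_ex by blast
    with Suc.prems show ?thesis by (intro exI[of _ "Suc k"]) auto
  qed
qed

text \<open>This locates the start of the \<open>j\<close>-th block: the displacement
  \<open>c\<close> of \<open>x\<close> under multiplication by \<open>d\<close> is itself scaled by
  \<open>d\<close> at each step.\<close>

lemma cong_power_mult_geometric:
  fixes x c d n :: nat
  assumes "[d * x = x + c] (mod n)"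
  shows "[d ^ j * x = x + c * (\<Sum>i<j. d ^ i)] (mod n)"
proof (induction j)
  case 0
  then show ?case by simp
next
  case (Suc j)
  have "[d ^ j * (d * x) = d ^ j * (x + c)] (mod n)"
    using assms by (intro cong_mult cong_refl)
  then have "[d ^ Suc j * x = d ^ j * x + c * d ^ j] (mod n)"
    by (simp add: algebra_simps)
  moreover have "[d ^ j * x + c * d ^ j = x + c * (\<Sum>i<j. d ^ i) + c * d ^ j] (mod n)"
    using Suc.IH by (intro cong_add cong_refl)
  ultimately have "[d ^ Suc j * x = x + c * (\<Sum>i<j. d ^ i) + c * d ^ j] (mod n)"
    by (rule cong_trans)
  then show ?case by (simp add: algebra_simps)
qed

text \<open>Measured from \<open>x\<close>, the residues reached in \<open>j\<close> steps from the
  \<open>t\<close> vertices are those of an interval of length \<open>d ^ j * t\<close> starting at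
  \<open>c * (\<Sum>i<j. d ^ i)\<close>. By \<open>len\<close> these intervals fill a full
  period.\<close>

lemma gen_de_bruijn_block_dominating:
  fixes x c d n t k :: nat
  assumes "n > 0" "d > 0" and cong: "[d * x = x + c] (mod n)" and "c \<le> t"
    and len: "n \<le> c * (\<Sum>i<k. d ^ i) + d ^ k * t"
  shows "distance_dominating (with_proj (gen_de_bruijn n d)) k ((\<lambda>a. (x + a) mod n) ` {..<t})"
  unfolding gen_de_bruijn_dominating_iff[OF assms(2)]
proof (intro conjI allI impI)
  show "(\<lambda>a. (x + a) mod n) ` {..<t} \<subseteq> {0..<n}" using assms(1) by auto
next
  fix v assume "v < n"
  \<comment> \<open>This is \<open>v - x\<close> modulo \<open>n\<close>; the multiple
    \<open>n * x\<close> keeps the subtraction within the naturals.\<close>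
  define q where "q = (v + (n * x - x)) mod n"
  have "[x + q = x + (v + (n * x - x))] (mod n)"
    by (simp add: q_def cong_def mod_add_right_eq)
  also have "x + (v + (n * x - x)) = v + n * x"
    using assms(1) by (cases n) auto
  also have "[v + n * x = v] (mod n)" by (simp add: cong_def)
  finally have v: "[v = x + q] (mod n)" by (rule cong_sym)
  have "q < c * (\<Sum>i<k. d ^ i) + d ^ k * t"
    using len assms(1) by (simp add: q_def order_less_le_trans[OF mod_less_divisor])
  then obtain j p where j: "j \<le> k" and p: "p < d ^ j * t" and q: "q = c * (\<Sum>i<j. d ^ i) + p"
    using consecutive_blocks_cover assms(4) by blast
  \<comment> \<open>The quotient names the vertex of the initial block, the remainder the offset
    among its \<open>d ^ j\<close> walk endpoints.\<close>
  define a where "a = p div d ^ j"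
  have a: "a < t" using p by (simp add: a_def less_mult_imp_div_less mult.commute)
  have r: "p mod d ^ j < d ^ j" using assms(2) by simp
  have "[d ^ j * ((x + a) mod n) + p mod d ^ j = d ^ j * (x + a) + p mod d ^ j] (mod n)"
    by (intro cong_add cong_mult cong_refl) simp
  also have "d ^ j * (x + a) + p mod d ^ j = d ^ j * x + p"
    by (simp add: a_def algebra_simps)
  also have "[d ^ j * x + p = x + c * (\<Sum>i<j. d ^ i) + p] (mod n)"
    by (intro cong_add cong_refl cong_power_mult_geometric cong)
  also have "x + c * (\<Sum>i<j. d ^ i) + p = x + q" by (simp add: q)
  finally have "[v = d ^ j * ((x + a) mod n) + p mod d ^ j] (mod n)"
    using v cong_sym cong_trans by blast
  with a j r show "\<exists>u\<in>(\<lambda>a. (x + a) mod n) ` {..<t}. \<exists>j\<le>k. \<exists>r<d ^ j. [v = d ^ j * u + r] (mod n)"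
    by blast
qed

lemma ex_gen_de_bruijn_dominating_card_le:
  fixes n d k m :: nat
  assumes "n > 0" "d \<ge> 2" and m: "n \<le> m * (\<Sum>j=0..k. d ^ j)"
  shows "\<exists>D. finite D \<and> distance_dominating (with_proj (gen_de_bruijn n d)) k D \<and> card D \<le> m + 1"
proof -
  define A where "A = (\<Sum>i<k. d ^ i)"
  define t where "t = m + 1"
  define g where "g = gcd (d - 1) n"
  define c where "c = t - t mod g"
  have S: "(\<Sum>j=0..k. d ^ j) = A + d ^ k"
    by (simp add: A_def atLeast0AtMost lessThan_Suc_atMost[symmetric])
  have g: "g > 0" "g \<le> d - 1"
    using assms by (auto simp: g_def intro: gcd_le1_nat)
  have "g dvd c" by (simp add: c_def dvd_minus_mod)
  then obtain x where x: "[(d - 1) * x = c] (mod n)"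
    using cong_solve_dvd_nat unfolding g_def by blast
  then have "[x + (d - 1) * x = x + c] (mod n)" by (intro cong_add cong_refl)
  then have cong: "[d * x = x + c] (mod n)"
    using assms(2) by (cases d) auto
  have ct: "c + t mod g = t" by (simp add: c_def)
  have "d ^ k = (d - 1) * A + 1"
    unfolding A_def
  proof (induction k)
    case (Suc k)
    have "d ^ Suc k = (d - 1) * d ^ k + d ^ k" using assms(2) by (cases d) auto
    with Suc show ?case by (simp add: algebra_simps)
  qed simp
  \<comment> \<open>The overlap loss \<open>t mod g * A\<close> is at most
    \<open>(d - 1) * A = d ^ k - 1\<close>, less than the contribution \<open>A + d ^ k\<close> of
    the extra vertex.\<close>
  moreover have "t mod g * A \<le> (d - 1) * A"
    using g mod_less_divisor[of g t] by (intro mult_le_mono1) linarith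
  ultimately have "t mod g * A \<le> A + d ^ k" by linarith
  moreover have "c * A + d ^ k * t + t mod g * A = m * (A + d ^ k) + (A + d ^ k)"
  proof -
    have "c * A + d ^ k * t + t mod g * A = (c + t mod g) * A + d ^ k * t"
      by (simp add: algebra_simps)
    also have "\<dots> = m * (A + d ^ k) + (A + d ^ k)"
      unfolding ct by (simp add: t_def algebra_simps)
    finally show ?thesis .
  qed
  ultimately have "n \<le> c * A + d ^ k * t" using m unfolding S by linarith
  then have "distance_dominating (with_proj (gen_de_bruijn n d)) k ((\<lambda>a. (x + a) mod n) ` {..<t})"
    using assms cong ct unfolding A_def by (intro gen_de_bruijn_block_dominating) auto
  \<comment> \<open>Only an inequality: for \<open>t > n\<close> the residues repeat.\<close>
  moreover have "card ((\<lambda>a. (x + a) mod n) ` {..<t}) \<le> m + 1"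
    using card_image_le[of "{..<t}"] by (simp add: t_def)
  ultimately show ?thesis by blast
qed

theorem theorem2p1:
  fixes n d k :: nat
  assumes "d \<ge> 2" and "n \<ge> d" and "k \<ge> 1"
  shows "int (distance_domination_number (with_proj (gen_de_bruijn n d)) k)
           = \<lceil>real n / (\<Sum>j=0..k. real d ^ j)\<rceil>
       \<or> int (distance_domination_number (with_proj (gen_de_bruijn n d)) k)
           = \<lceil>real n / (\<Sum>j=0..k. real d ^ j)\<rceil> + 1"
proof -
  let ?G = "with_proj (gen_de_bruijn n d)"
  define S where "S = (\<Sum>j=0..k. d ^ j)"
  define m where "m = nat \<lceil>real n / real S\<rceil>"
  have S: "(\<Sum>j=0..k. real d ^ j) = real S" by (simp add: S_def)
  have "S > 0" using assms(1) by (auto simp: S_def intro!: sum_pos)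
  have ceil: "\<lceil>real n / real S\<rceil> = int m"
    unfolding m_def by (simp del: int_nat_eq add: ceiling_mono[of 0, simplified])
  obtain D where D: "distance_dominating ?G k D" "card D = distance_domination_number ?G k"
    using distance_domination_number_attained[of ?G k] by (auto simp: gen_de_bruijn_def)
  have "n \<le> distance_domination_number ?G k * S"
    using gen_de_bruijn_dominating_card_ge[OF _ D(1)] assms(1) by (simp add: D(2) S_def)
  then have "real n \<le> real (distance_domination_number ?G k) * real S"
    by (metis of_nat_le_iff of_nat_mult)
  then have lower: "int m \<le> int (distance_domination_number ?G k)"
    using \<open>S > 0\<close> unfolding ceil[symmetric] by (simp add: ceiling_le_iff divide_le_eq)
  \<comment> \<open>The ceiling is used in both directions: its minimality gave
    \<open>lower\<close>, and \<open>n \<le> m * S\<close> is what the block construction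
    requires.\<close>
  have "real n / real S \<le> real m"
    using ceil by (metis le_of_int_ceiling of_int_of_nat_eq)
  then have "real n \<le> real (m * S)" using \<open>S > 0\<close> by (simp add: divide_le_eq)
  then have "n \<le> m * S" by (simp only: of_nat_le_iff)
  then obtain E where E: "finite E" "distance_dominating ?G k E" "card E \<le> m + 1"
    using ex_gen_de_bruijn_dominating_card_le[of n d m k] assms by (auto simp: S_def)
  then have "distance_domination_number ?G k \<le> card E"
    unfolding distance_domination_number_def by (intro Least_le) blast
  with E(3) lower show ?thesis unfolding S ceil by linarith
qed

end
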